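(* Let $f:A\to B$ be a surjective ring homomorphism such that $\ker(f)$ is a prime ideal of $A$. Assume that every regular ideal of $B$ can be lifted via $f$ to a regular ideal of $A$, i.e. for every regular ideal $I$ of $B$ the ideal $f^{-1}(I)$ of $A$ is regular. If $A$ is an ISP-ring, then so is $B$.
   Context: All rings are commutative with a nonzero unit. An element of a ring is regular if it is not a zero-divisor; an ideal is regular if it contains at least one regular element. A proper ideal $H$ is a radical ideal if $\sqrt H=H$. An ideal $J$ of $A$ is invertible if $JJ'=A$ for some $A$-submodule $J'$ of the total quotient ring $T(A)$; equivalently, $J$ is finitely generated, regular, and $J_M$ is a principal ideal of $A_M$ for each maximal ideal $M$ of $A$ (the ideal $A$ itself is allowed). A ring $A$ is an ISP-ring if every proper regular ideal of $A$ can be written as $JH_1\cdots H_n$ with $J$ an invertible ideal, $n\ge 1$, and all $H_i$ proper radical ideals. *)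

theory Defs
  imports "HOL-Algebra.Ideal_Product" "HOL-Algebra.Module" "HOL-Algebra.RingHom"
begin

section \<open>Regular elements and regular ideals\<close>

definition regular_elements :: "('a, 'm) ring_scheme \<Rightarrow> 'a set" where
  "regular_elements R =
     {a \<in> carrier R. \<forall>x \<in> carrier R. a \<otimes>\<^bsub>R\<^esub> x = \<zero>\<^bsub>R\<^esub> \<longrightarrow> x = \<zero>\<^bsub>R\<^esub>}"

definition regular_ideal :: "'a set \<Rightarrow> ('a, 'm) ring_scheme \<Rightarrow> bool" where
  "regular_ideal I R \<longleftrightarrow> ideal I R \<and> I \<inter> regular_elements R \<noteq> {}"

section \<open>Radical ideals\<close>

definition ideal_radical :: "('a, 'm) ring_scheme \<Rightarrow> 'a set \<Rightarrow> 'a set" where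
  "ideal_radical R I = {x \<in> carrier R. \<exists>n::nat. n > 0 \<and> x [^]\<^bsub>R\<^esub> n \<in> I}"

definition radical_ideal :: "'a set \<Rightarrow> ('a, 'm) ring_scheme \<Rightarrow> bool" where
  "radical_ideal H R \<longleftrightarrow> ideal H R \<and> H \<noteq> carrier R \<and> ideal_radical R H = H"

section \<open>The total quotient ring\<close>

text \<open>Since the denominators are regular, \<open>a/s = b/t\<close> can be read as \<open>a t = b s\<close>; the extra
  factor needed for a general localization is superfluous.\<close>

definition frac_rel :: "('a, 'm) ring_scheme \<Rightarrow> (('a \<times> 'a) \<times> ('a \<times> 'a)) set" where
  "frac_rel R =
     {((a, s), (b, t)). a \<in> carrier R \<and> s \<in> regular_elements R \<and>
        b \<in> carrier R \<and> t \<in> regular_elements R \<and> a \<otimes>\<^bsub>R\<^esub> t = b \<otimes>\<^bsub>R\<^esub> s}"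

definition quot_frac :: "('a, 'm) ring_scheme \<Rightarrow> 'a \<Rightarrow> 'a \<Rightarrow> ('a \<times> 'a) set" where
  "quot_frac R a s = frac_rel R `` {(a, s)}"

text \<open>The total quotient ring carries its structure of an algebra over the base ring, so that
  the library notion of submodule applies to it. Operations on classes are unions over all
  representatives; these are unions of a single class by well-definedness, see
  \<open>total_quotient_ops\<close> below.\<close>

definition total_quotient :: "('a, 'm) ring_scheme \<Rightarrow> ('a, ('a \<times> 'a) set) module" where
  "total_quotient R =
     \<lparr> carrier = (carrier R \<times> regular_elements R) // frac_rel R,
       mult = (\<lambda>X Y. \<Union>(a, s) \<in> X. \<Union>(b, t) \<in> Y. quot_frac R (a \<otimes>\<^bsub>R\<^esub> b) (s \<otimes>\<^bsub>R\<^esub> t)),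
       one = quot_frac R \<one>\<^bsub>R\<^esub> \<one>\<^bsub>R\<^esub>,
       zero = quot_frac R \<zero>\<^bsub>R\<^esub> \<one>\<^bsub>R\<^esub>,
       add = (\<lambda>X Y. \<Union>(a, s) \<in> X. \<Union>(b, t) \<in> Y.
                quot_frac R (a \<otimes>\<^bsub>R\<^esub> t \<oplus>\<^bsub>R\<^esub> b \<otimes>\<^bsub>R\<^esub> s) (s \<otimes>\<^bsub>R\<^esub> t)),
       smult = (\<lambda>c X. \<Union>(a, s) \<in> X. quot_frac R (c \<otimes>\<^bsub>R\<^esub> a) s) \<rparr>"

definition to_total_quotient :: "('a, 'm) ring_scheme \<Rightarrow> 'a \<Rightarrow> ('a \<times> 'a) set" where
  "to_total_quotient R a = quot_frac R a \<one>\<^bsub>R\<^esub>"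

section \<open>Invertible ideals and ISP-rings\<close>

text \<open>The product \<open>J J'\<close> is formed inside the total quotient ring: \<^const>\<open>ideal_prod\<close> only closes
  the elementwise products under finite sums, so it applies to submodules as well. As usual \<open>R\<close>
  and its ideals are identified with their (injective) images in the total quotient ring.\<close>

definition invertible_ideal :: "'a set \<Rightarrow> ('a, 'm) ring_scheme \<Rightarrow> bool" where
  "invertible_ideal J R \<longleftrightarrow> ideal J R \<and>
     (\<exists>J'. submodule J' R (total_quotient R) \<and>
        (to_total_quotient R ` J) \<cdot>\<^bsub>total_quotient R\<^esub> J' = to_total_quotient R ` carrier R)"

locale ISP_ring = cring +
  assumes one_not_zero: "\<one> \<noteq> \<zero>"
    and ISP: "\<And>I. regular_ideal I R \<Longrightarrow> I \<noteq> carrier R \<Longrightarrow>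
      \<exists>J Hs. invertible_ideal J R \<and> Hs \<noteq> [] \<and> (\<forall>H \<in> set Hs. radical_ideal H R) \<and>
        I = foldl (ideal_prod R) J Hs"

section \<open>Basic facts about the total quotient ring\<close>

context cring
begin

lemma regular_carr [simp]: "s \<in> regular_elements R \<Longrightarrow> s \<in> carrier R"
  by (simp add: regular_elements_def)

lemma regular_one [simp]: "\<one> \<in> regular_elements R"
proof -
  have "x = \<zero>" if "x \<in> carrier R" "\<one> \<otimes> x = \<zero>" for x
    using that by (simp only: l_one)
  then show ?thesis
    unfolding regular_elements_def using one_closed by blast
qed

lemma regular_mult [simp]:
  assumes "s \<in> regular_elements R" "t \<in> regular_elements R"
  shows "s \<otimes> t \<in> regular_elements R"
proof -
  have carr: "s \<in> carrier R" "t \<in> carrier R" using assms by auto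
  have "x = \<zero>" if "x \<in> carrier R" "s \<otimes> t \<otimes> x = \<zero>" for x
  proof -
    have "s \<otimes> (t \<otimes> x) = \<zero>" using that carr by (simp add: m_assoc)
    then have "t \<otimes> x = \<zero>" using assms(1) that(1) carr unfolding regular_elements_def by blast
    then show "x = \<zero>" using assms(2) that(1) unfolding regular_elements_def by blast
  qed
  with carr show ?thesis unfolding regular_elements_def by blast
qed

lemma regular_cancel:
  assumes "s \<in> regular_elements R" "a \<in> carrier R" "b \<in> carrier R" "s \<otimes> a = s \<otimes> b"
  shows "a = b"
proof -
  have s: "s \<in> carrier R" using assms(1) by simp
  have "s \<otimes> (a \<ominus> b) = \<zero>"
    using assms s by (simp add: a_minus_def r_distr r_minus r_neg)
  moreover have "a \<ominus> b \<in> carrier R" using assms by simp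
  ultimately have "a \<ominus> b = \<zero>"
    using assms(1) unfolding regular_elements_def by blast
  then show ?thesis
    using assms(2,3) by (metis a_minus_def add.inv_closed minus_equality minus_minus)
qed

lemma frac_rel_equiv: "equiv (carrier R \<times> regular_elements R) (frac_rel R)"
proof (rule equivI)
  show "trans (frac_rel R)"
  proof (rule transI, clarsimp simp: frac_rel_def)
    fix a s b t c u
    assume *: "a \<in> carrier R" "s \<in> regular_elements R" "b \<in> carrier R" "t \<in> regular_elements R"
      "c \<in> carrier R" "u \<in> regular_elements R" "a \<otimes> t = b \<otimes> s" "b \<otimes> u = c \<otimes> t"
    have carr: "s \<in> carrier R" "t \<in> carrier R" "u \<in> carrier R" using * by auto
    have "t \<otimes> (a \<otimes> u) = (a \<otimes> t) \<otimes> u" using *(1-6) carr by (simp add: m_ac)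
    also have "\<dots> = (b \<otimes> u) \<otimes> s" unfolding *(7) using *(1-6) carr by (simp add: m_ac)
    also have "\<dots> = t \<otimes> (c \<otimes> s)" unfolding *(8) using *(1-6) carr by (simp add: m_ac)
    finally have eq: "t \<otimes> (a \<otimes> u) = t \<otimes> (c \<otimes> s)" .
    show "a \<otimes> u = c \<otimes> s"
      by (rule regular_cancel[OF *(4) _ _ eq]) (use *(1-6) carr in simp_all)
  qed
next
  show "frac_rel R \<subseteq> (carrier R \<times> regular_elements R) \<times> (carrier R \<times> regular_elements R)"
    unfolding frac_rel_def by blast
  show "refl_on (carrier R \<times> regular_elements R) (frac_rel R)"
    unfolding frac_rel_def refl_on_def by blast
  show "sym (frac_rel R)"
    unfolding frac_rel_def by (rule symI) force
qed

lemma frac_eq_iff: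
  assumes "a \<in> carrier R" "s \<in> regular_elements R" "b \<in> carrier R" "t \<in> regular_elements R"
  shows "quot_frac R a s = quot_frac R b t \<longleftrightarrow> a \<otimes> t = b \<otimes> s"
  unfolding quot_frac_def using assms
  by (subst eq_equiv_class_iff[OF frac_rel_equiv]) (auto simp: frac_rel_def)

lemma total_quotient_carrier:
  "carrier (total_quotient R) = {quot_frac R a s | a s. a \<in> carrier R \<and> s \<in> regular_elements R}"
  by (auto simp: total_quotient_def quot_frac_def quotient_def)

lemma frac_memI [simp]:
  "a \<in> carrier R \<Longrightarrow> s \<in> regular_elements R \<Longrightarrow> quot_frac R a s \<in> carrier (total_quotient R)"
  by (auto simp: total_quotient_carrier)

lemma frac_UN:
  assumes "a \<in> carrier R" "s \<in> regular_elements R"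
    and "\<And>b t. b \<in> carrier R \<Longrightarrow> t \<in> regular_elements R \<Longrightarrow> a \<otimes> t = b \<otimes> s \<Longrightarrow> F b t = F a s"
  shows "(\<Union>(b, t) \<in> quot_frac R a s. F b t) = F a s"
proof -
  have "(a, s) \<in> quot_frac R a s" using assms by (simp add: quot_frac_def frac_rel_def)
  moreover have "F b t = F a s" if "(b, t) \<in> quot_frac R a s" for b t
    by (rule assms(3)) (use that in \<open>simp_all add: quot_frac_def frac_rel_def\<close>)
  ultimately show ?thesis by blast
qed

lemma total_quotient_mult:
  assumes "a \<in> carrier R" "s \<in> regular_elements R" "b \<in> carrier R" "t \<in> regular_elements R"
  shows "quot_frac R a s \<otimes>\<^bsub>total_quotient R\<^esub> quot_frac R b t = quot_frac R (a \<otimes> b) (s \<otimes> t)"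
proof -
  have 1: "(\<Union>(b', t') \<in> quot_frac R b t. quot_frac R (a' \<otimes> b') (s' \<otimes> t')) = quot_frac R (a' \<otimes> b) (s' \<otimes> t)"
    if "a' \<in> carrier R" "s' \<in> regular_elements R" for a' s'
  proof (rule frac_UN[OF assms(3,4)])
    fix b' t' assume *: "b' \<in> carrier R" "t' \<in> regular_elements R" "b \<otimes> t' = b' \<otimes> t"
    have carr: "s' \<in> carrier R" "t \<in> carrier R" "t' \<in> carrier R" using * assms that by auto
    have "a' \<otimes> b' \<otimes> (s' \<otimes> t) = (a' \<otimes> s') \<otimes> (b' \<otimes> t)"
      using *(1,2) assms that carr by (simp add: m_ac)
    also have "\<dots> = a' \<otimes> b \<otimes> (s' \<otimes> t')"
      unfolding *(3)[symmetric] using *(1,2) assms that carr by (simp add: m_ac)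
    finally show "quot_frac R (a' \<otimes> b') (s' \<otimes> t') = quot_frac R (a' \<otimes> b) (s' \<otimes> t)"
      using * assms that by (simp add: frac_eq_iff)
  qed
  have "quot_frac R a s \<otimes>\<^bsub>total_quotient R\<^esub> quot_frac R b t =
    (\<Union>(a', s') \<in> quot_frac R a s. \<Union>(b', t') \<in> quot_frac R b t. quot_frac R (a' \<otimes> b') (s' \<otimes> t'))"
    by (simp add: total_quotient_def)
  also have "\<dots> = (\<Union>(b', t') \<in> quot_frac R b t. quot_frac R (a \<otimes> b') (s \<otimes> t'))"
  proof (rule frac_UN[OF assms(1,2)])
    fix a' s' assume *: "a' \<in> carrier R" "s' \<in> regular_elements R" "a \<otimes> s' = a' \<otimes> s"
    have carr: "s \<in> carrier R" "s' \<in> carrier R" "t \<in> carrier R" using * assms by auto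
    have "a' \<otimes> b \<otimes> (s \<otimes> t) = (a' \<otimes> s) \<otimes> (b \<otimes> t)" using *(1,2) assms carr by (simp add: m_ac)
    also have "\<dots> = a \<otimes> b \<otimes> (s' \<otimes> t)"
      unfolding *(3)[symmetric] using *(1,2) assms carr by (simp add: m_ac)
    finally show "(\<Union>(b', t') \<in> quot_frac R b t. quot_frac R (a' \<otimes> b') (s' \<otimes> t')) =
      (\<Union>(b', t') \<in> quot_frac R b t. quot_frac R (a \<otimes> b') (s \<otimes> t'))"
      using * assms by (simp add: 1 frac_eq_iff)
  qed
  finally show ?thesis using 1 assms by simp
qed

lemma total_quotient_add:
  assumes "a \<in> carrier R" "s \<in> regular_elements R" "b \<in> carrier R" "t \<in> regular_elements R"
  shows "quot_frac R a s \<oplus>\<^bsub>total_quotient R\<^esub> quot_frac R b t = quot_frac R (a \<otimes> t \<oplus> b \<otimes> s) (s \<otimes> t)"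
proof -
  have 1: "(\<Union>(b', t') \<in> quot_frac R b t. quot_frac R (a' \<otimes> t' \<oplus> b' \<otimes> s') (s' \<otimes> t')) =
      quot_frac R (a' \<otimes> t \<oplus> b \<otimes> s') (s' \<otimes> t)"
    if "a' \<in> carrier R" "s' \<in> regular_elements R" for a' s'
  proof (rule frac_UN[OF assms(3,4)])
    fix b' t' assume *: "b' \<in> carrier R" "t' \<in> regular_elements R" "b \<otimes> t' = b' \<otimes> t"
    have carr: "s' \<in> carrier R" "t \<in> carrier R" "t' \<in> carrier R" using * assms that by auto
    have "(a' \<otimes> t' \<oplus> b' \<otimes> s') \<otimes> (s' \<otimes> t) = a' \<otimes> s' \<otimes> t \<otimes> t' \<oplus> (s' \<otimes> s') \<otimes> (b' \<otimes> t)"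
      using *(1,2) assms that carr by (simp add: m_ac l_distr r_distr)
    also have "\<dots> = (a' \<otimes> t \<oplus> b \<otimes> s') \<otimes> (s' \<otimes> t')"
      unfolding *(3)[symmetric] using *(1,2) assms that carr by (simp add: m_ac l_distr r_distr)
    finally show "quot_frac R (a' \<otimes> t' \<oplus> b' \<otimes> s') (s' \<otimes> t') = quot_frac R (a' \<otimes> t \<oplus> b \<otimes> s') (s' \<otimes> t)"
      using * assms that by (simp add: frac_eq_iff)
  qed
  have "quot_frac R a s \<oplus>\<^bsub>total_quotient R\<^esub> quot_frac R b t =
    (\<Union>(a', s') \<in> quot_frac R a s. \<Union>(b', t') \<in> quot_frac R b t. quot_frac R (a' \<otimes> t' \<oplus> b' \<otimes> s') (s' \<otimes> t'))"
    by (simp add: total_quotient_def)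
  also have "\<dots> = (\<Union>(b', t') \<in> quot_frac R b t. quot_frac R (a \<otimes> t' \<oplus> b' \<otimes> s) (s \<otimes> t'))"
  proof (rule frac_UN[OF assms(1,2)])
    fix a' s' assume *: "a' \<in> carrier R" "s' \<in> regular_elements R" "a \<otimes> s' = a' \<otimes> s"
    have carr: "s \<in> carrier R" "s' \<in> carrier R" "t \<in> carrier R" using * assms by auto
    have "(a' \<otimes> t \<oplus> b \<otimes> s') \<otimes> (s \<otimes> t) = (t \<otimes> t) \<otimes> (a' \<otimes> s) \<oplus> b \<otimes> s \<otimes> s' \<otimes> t"
      using *(1,2) assms carr by (simp add: m_ac l_distr r_distr)
    also have "\<dots> = (a \<otimes> t \<oplus> b \<otimes> s) \<otimes> (s' \<otimes> t)"
      unfolding *(3)[symmetric] using *(1,2) assms carr by (simp add: m_ac l_distr r_distr)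
    finally show "(\<Union>(b', t') \<in> quot_frac R b t. quot_frac R (a' \<otimes> t' \<oplus> b' \<otimes> s') (s' \<otimes> t')) =
      (\<Union>(b', t') \<in> quot_frac R b t. quot_frac R (a \<otimes> t' \<oplus> b' \<otimes> s) (s \<otimes> t'))"
      using * assms by (simp add: 1 frac_eq_iff)
  qed
  finally show ?thesis using 1 assms by simp
qed

lemma total_quotient_smult:
  assumes "c \<in> carrier R" "a \<in> carrier R" "s \<in> regular_elements R"
  shows "c \<odot>\<^bsub>total_quotient R\<^esub> quot_frac R a s = quot_frac R (c \<otimes> a) s"
proof -
  have "(\<Union>(a', s') \<in> quot_frac R a s. quot_frac R (c \<otimes> a') s') = quot_frac R (c \<otimes> a) s"
    by (rule frac_UN[OF assms(2,3)]) (use assms in \<open>simp add: frac_eq_iff m_assoc\<close>)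
  then show ?thesis by (simp add: total_quotient_def)
qed

lemma total_quotient_one: "\<one>\<^bsub>total_quotient R\<^esub> = quot_frac R \<one> \<one>"
  and total_quotient_zero: "\<zero>\<^bsub>total_quotient R\<^esub> = quot_frac R \<zero> \<one>"
  by (simp_all add: total_quotient_def)

lemmas total_quotient_ops =
  total_quotient_mult total_quotient_add total_quotient_smult total_quotient_one total_quotient_zero

lemma total_quotient_cases:
  assumes "X \<in> carrier (total_quotient R)"
  obtains a s where "X = quot_frac R a s" "a \<in> carrier R" "s \<in> regular_elements R" "s \<in> carrier R"
  using assms by (auto simp: total_quotient_carrier)

lemma total_quotient_abelian_group: "abelian_group (total_quotient R)"
proof (rule abelian_groupI)
  fix X Y assume "X \<in> carrier (total_quotient R)" "Y \<in> carrier (total_quotient R)"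
  then show "X \<oplus>\<^bsub>total_quotient R\<^esub> Y \<in> carrier (total_quotient R)"
    by (elim total_quotient_cases) (simp add: total_quotient_add)
next
  fix X Y Z assume "X \<in> carrier (total_quotient R)" "Y \<in> carrier (total_quotient R)"
    "Z \<in> carrier (total_quotient R)"
  then show "(X \<oplus>\<^bsub>total_quotient R\<^esub> Y) \<oplus>\<^bsub>total_quotient R\<^esub> Z =
      X \<oplus>\<^bsub>total_quotient R\<^esub> (Y \<oplus>\<^bsub>total_quotient R\<^esub> Z)"
    by (elim total_quotient_cases) (simp add: total_quotient_add l_distr r_distr m_ac a_ac)
next
  fix X Y assume "X \<in> carrier (total_quotient R)" "Y \<in> carrier (total_quotient R)"
  then show "X \<oplus>\<^bsub>total_quotient R\<^esub> Y = Y \<oplus>\<^bsub>total_quotient R\<^esub> X"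
    by (elim total_quotient_cases) (simp add: total_quotient_add m_ac a_ac)
next
  fix X assume "X \<in> carrier (total_quotient R)"
  then obtain a s where X: "X = quot_frac R a s" "a \<in> carrier R" "s \<in> regular_elements R"
      "s \<in> carrier R" by (rule total_quotient_cases)
  show "\<zero>\<^bsub>total_quotient R\<^esub> \<oplus>\<^bsub>total_quotient R\<^esub> X = X"
    using X by (simp add: total_quotient_add total_quotient_zero)
  have "quot_frac R (\<ominus> a) s \<oplus>\<^bsub>total_quotient R\<^esub> X = \<zero>\<^bsub>total_quotient R\<^esub>"
    using X by (simp add: total_quotient_add total_quotient_zero frac_eq_iff l_minus l_neg)
  with X show "\<exists>Y \<in> carrier (total_quotient R). Y \<oplus>\<^bsub>total_quotient R\<^esub> X = \<zero>\<^bsub>total_quotient R\<^esub>"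
    by (intro bexI[of _ "quot_frac R (\<ominus> a) s"]) auto
qed (simp add: total_quotient_zero)

lemma total_quotient_comm_monoid: "comm_monoid (total_quotient R)"
proof (rule comm_monoidI)
  fix X Y assume "X \<in> carrier (total_quotient R)" "Y \<in> carrier (total_quotient R)"
  then show "X \<otimes>\<^bsub>total_quotient R\<^esub> Y \<in> carrier (total_quotient R)"
    by (elim total_quotient_cases) (simp add: total_quotient_mult)
next
  fix X Y Z assume "X \<in> carrier (total_quotient R)" "Y \<in> carrier (total_quotient R)"
    "Z \<in> carrier (total_quotient R)"
  then show "(X \<otimes>\<^bsub>total_quotient R\<^esub> Y) \<otimes>\<^bsub>total_quotient R\<^esub> Z =
      X \<otimes>\<^bsub>total_quotient R\<^esub> (Y \<otimes>\<^bsub>total_quotient R\<^esub> Z)"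
    by (elim total_quotient_cases) (simp add: total_quotient_mult m_ac)
next
  fix X Y assume "X \<in> carrier (total_quotient R)" "Y \<in> carrier (total_quotient R)"
  then show "X \<otimes>\<^bsub>total_quotient R\<^esub> Y = Y \<otimes>\<^bsub>total_quotient R\<^esub> X"
    by (elim total_quotient_cases) (simp add: total_quotient_mult m_ac)
next
  fix X assume "X \<in> carrier (total_quotient R)"
  then show "\<one>\<^bsub>total_quotient R\<^esub> \<otimes>\<^bsub>total_quotient R\<^esub> X = X"
    by (elim total_quotient_cases) (simp add: total_quotient_mult total_quotient_one)
qed (simp add: total_quotient_one)

lemma total_quotient_cring: "cring (total_quotient R)"
proof (rule cringI[OF total_quotient_abelian_group total_quotient_comm_monoid])
  fix X Y Z assume "X \<in> carrier (total_quotient R)" "Y \<in> carrier (total_quotient R)"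
    "Z \<in> carrier (total_quotient R)"
  then show "(X \<oplus>\<^bsub>total_quotient R\<^esub> Y) \<otimes>\<^bsub>total_quotient R\<^esub> Z =
      X \<otimes>\<^bsub>total_quotient R\<^esub> Z \<oplus>\<^bsub>total_quotient R\<^esub> Y \<otimes>\<^bsub>total_quotient R\<^esub> Z"
    by (elim total_quotient_cases)
      (simp add: total_quotient_mult total_quotient_add frac_eq_iff l_distr r_distr m_ac)
qed

lemma total_quotient_algebra: "algebra R (total_quotient R)"
proof (rule algebraI[OF is_cring total_quotient_cring])
  fix c X assume c: "c \<in> carrier R" and "X \<in> carrier (total_quotient R)"
  then show "c \<odot>\<^bsub>total_quotient R\<^esub> X \<in> carrier (total_quotient R)"
    by (elim total_quotient_cases) (simp add: total_quotient_smult)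
next
  fix c d X assume "c \<in> carrier R" "d \<in> carrier R" and "X \<in> carrier (total_quotient R)"
  then show "(c \<oplus> d) \<odot>\<^bsub>total_quotient R\<^esub> X =
      c \<odot>\<^bsub>total_quotient R\<^esub> X \<oplus>\<^bsub>total_quotient R\<^esub> d \<odot>\<^bsub>total_quotient R\<^esub> X"
    by (elim total_quotient_cases)
      (simp add: total_quotient_smult total_quotient_add frac_eq_iff l_distr r_distr m_ac)
next
  fix c X Y assume "c \<in> carrier R" "X \<in> carrier (total_quotient R)"
    "Y \<in> carrier (total_quotient R)"
  then show "c \<odot>\<^bsub>total_quotient R\<^esub> (X \<oplus>\<^bsub>total_quotient R\<^esub> Y) =
      c \<odot>\<^bsub>total_quotient R\<^esub> X \<oplus>\<^bsub>total_quotient R\<^esub> c \<odot>\<^bsub>total_quotient R\<^esub> Y"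
    by (elim total_quotient_cases)
      (simp add: total_quotient_smult total_quotient_add r_distr m_ac)
next
  fix c d X assume "c \<in> carrier R" "d \<in> carrier R" and "X \<in> carrier (total_quotient R)"
  then show "(c \<otimes> d) \<odot>\<^bsub>total_quotient R\<^esub> X =
      c \<odot>\<^bsub>total_quotient R\<^esub> (d \<odot>\<^bsub>total_quotient R\<^esub> X)"
    by (elim total_quotient_cases) (simp add: total_quotient_smult m_assoc)
next
  fix X assume "X \<in> carrier (total_quotient R)"
  then show "\<one> \<odot>\<^bsub>total_quotient R\<^esub> X = X"
    by (elim total_quotient_cases) (simp add: total_quotient_smult)
next
  fix c X Y assume "c \<in> carrier R" "X \<in> carrier (total_quotient R)"
    "Y \<in> carrier (total_quotient R)"
  then show "(c \<odot>\<^bsub>total_quotient R\<^esub> X) \<otimes>\<^bsub>total_quotient R\<^esub> Y =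
      c \<odot>\<^bsub>total_quotient R\<^esub> (X \<otimes>\<^bsub>total_quotient R\<^esub> Y)"
    by (elim total_quotient_cases)
      (simp add: total_quotient_smult total_quotient_mult m_assoc)
qed

lemma to_total_quotient_hom: "to_total_quotient R \<in> ring_hom R (total_quotient R)"
  by (auto simp: ring_hom_def to_total_quotient_def total_quotient_ops)

lemma to_total_quotient_inj: "inj_on (to_total_quotient R) (carrier R)"
  by (auto simp: inj_on_def to_total_quotient_def frac_eq_iff)

lemma to_total_quotient_regular_Unit:
  assumes "s \<in> regular_elements R"
  shows "to_total_quotient R s \<in> Units (total_quotient R)"
proof -
  interpret T: cring "total_quotient R" by (rule total_quotient_cring)
  have s: "s \<in> carrier R" using assms by simp
  have "quot_frac R s \<one> \<otimes>\<^bsub>total_quotient R\<^esub> quot_frac R \<one> s = \<one>\<^bsub>total_quotient R\<^esub>"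
    using assms s
    by (simp add: total_quotient_mult total_quotient_one frac_eq_iff del: regular_carr)
  with assms s T.m_comm show ?thesis
    unfolding Units_def to_total_quotient_def
    by (metis (mono_tags, lifting) frac_memI mem_Collect_eq one_closed regular_one)
qed

end

end

theory Submission
  imports Defs "HOL-Algebra.QuotRing"
begin

text \<open>Let \<open>I\<close> be a proper regular ideal of \<open>B\<close> and write \<open>f\<inverse>(I) = J H\<^sub>1 \<cdots> H\<^sub>n\<close>. Every factor contains
  \<open>f\<inverse>(I)\<close>, hence the kernel, so each \<open>f(H\<^sub>i)\<close> is again a proper radical ideal, and
  \<open>I = f(J) f(H\<^sub>1) \<cdots> f(H\<^sub>n)\<close>. Moreover there is \<open>r \<in> J\<close> with \<open>f(r)\<close> regular. If \<open>x J \<subseteq> A\<close> with \<open>x\<close>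
  in the total quotient ring of \<open>A\<close>, then \<open>y = f(x r)/f(r)\<close> satisfies \<open>y f(j) = f(x j)\<close> for all
  \<open>j \<in> J\<close>; thus a relation \<open>1 = \<Sum> j\<^sub>i x\<^sub>i\<close> witnessing that \<open>J\<close> is invertible is carried to one for
  \<open>f(J)\<close>.\<close>

section \<open>Ideals under a surjective homomorphism\<close>

text \<open>Surjectivity matters for absorption: a multiplier from \<open>S\<close> has to be lifted
  to \<open>R\<close> before it can act on \<open>I\<close>.\<close>

lemma (in ring_hom_ring) image_ideal:
  assumes surj: "h ` carrier R = carrier S" and "ideal I R"
  shows "ideal (h ` I) S"
proof (rule idealI[OF S.ring_axioms])
  interpret I: ideal I R by fact
  show "subgroup (h ` I) (add_monoid S)"
    by (rule img_is_add_subgroup[OF I.a_subgroup])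
  fix a x assume "a \<in> h ` I" "x \<in> carrier S"
  then obtain i r where *: "i \<in> I" "a = h i" "r \<in> carrier R" "x = h r"
    using surj by blast
  then have "x \<otimes>\<^bsub>S\<^esub> a = h (r \<otimes> i)" "a \<otimes>\<^bsub>S\<^esub> x = h (i \<otimes> r)"
    by simp_all
  with * show "x \<otimes>\<^bsub>S\<^esub> a \<in> h ` I" "a \<otimes>\<^bsub>S\<^esub> x \<in> h ` I"
    using I.I_l_closed I.I_r_closed by blast+
qed

lemma (in ring_hom_ring) image_ideal_prod:
  assumes "ideal I R" "ideal J R"
  shows "h ` (I \<cdot> J) = (h ` I) \<cdot>\<^bsub>S\<^esub> (h ` J)"
proof
  interpret I: ideal I R by fact
  interpret J: ideal J R by fact
  \<comment> \<open>Both inductions need this in their sum case, because \<open>h\<close> is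
    additive only on the carrier.\<close>
  have carr: "I \<cdot> J \<subseteq> carrier R"
    using assms by (rule R.ideal_prod_in_carrier)
  have "h x \<in> (h ` I) \<cdot>\<^bsub>S\<^esub> (h ` J)" if "x \<in> I \<cdot> J" for x
    using that
  proof induction
    case (prod i j)
    then show ?case by (simp add: ideal_prod.prod)
  next
    case (sum s t)
    moreover have "s \<in> carrier R" "t \<in> carrier R" using sum.hyps carr by blast+
    ultimately show ?case by (simp add: ideal_prod.sum)
  qed
  then show "h ` (I \<cdot> J) \<subseteq> (h ` I) \<cdot>\<^bsub>S\<^esub> (h ` J)" by blast
  have "y \<in> h ` (I \<cdot> J)" if "y \<in> (h ` I) \<cdot>\<^bsub>S\<^esub> (h ` J)" for y
    using that
  proof induction
    case (prod a b)
    then obtain i j where "i \<in> I" "a = h i" "j \<in> J" "b = h j" by blast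
    then have "i \<otimes> j \<in> I \<cdot> J" "a \<otimes>\<^bsub>S\<^esub> b = h (i \<otimes> j)"
      by (simp_all add: ideal_prod.prod)
    then show ?case by blast
  next
    case (sum a b)
    then obtain s t where *: "s \<in> I \<cdot> J" "a = h s" "t \<in> I \<cdot> J" "b = h t" by blast
    moreover have "s \<in> carrier R" "t \<in> carrier R" using * carr by blast+
    ultimately have "s \<oplus> t \<in> I \<cdot> J" "a \<oplus>\<^bsub>S\<^esub> b = h (s \<oplus> t)"
      by (simp_all add: ideal_prod.sum)
    then show ?case by blast
  qed
  then show "(h ` I) \<cdot>\<^bsub>S\<^esub> (h ` J) \<subseteq> h ` (I \<cdot> J)" by blast
qed

text \<open>A product of two ideals lies in their intersection; the accumulator \<open>J\<close>
  varies in the induction. This passes the kernel from the whole product down to every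
  factor.\<close>

lemma (in ring) foldl_ideal_prod_subset:
  assumes "ideal J R" "\<forall>H \<in> set Hs. ideal H R"
  shows "foldl (ideal_prod R) J Hs \<subseteq> J \<and> (\<forall>H \<in> set Hs. foldl (ideal_prod R) J Hs \<subseteq> H)"
  using assms
proof (induction Hs arbitrary: J)
  case (Cons H Hs)
  have I: "ideal J R" "ideal H R" "\<forall>H' \<in> set Hs. ideal H' R" using Cons.prems by simp_all
  have "J \<cdot> H \<subseteq> J \<inter> H" using I(1,2) by (rule ideal_prod_inter)
  moreover have "foldl (ideal_prod R) (J \<cdot> H) Hs \<subseteq> J \<cdot> H \<and>
    (\<forall>H' \<in> set Hs. foldl (ideal_prod R) (J \<cdot> H) Hs \<subseteq> H')"
    using ideal_prod_is_ideal[OF I(1,2)] I(3) by (rule Cons.IH)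
  ultimately show ?case by (simp add: subset_iff)
qed simp

lemma (in ring_hom_ring) image_foldl_ideal_prod:
  assumes "ideal J R" "\<forall>H \<in> set Hs. ideal H R"
  shows "h ` foldl (ideal_prod R) J Hs = foldl (ideal_prod S) (h ` J) (map ((`) h) Hs)"
  using assms
proof (induction Hs arbitrary: J)
  case (Cons H Hs)
  then show ?case
    by (simp add: image_ideal_prod R.ideal_prod_is_ideal)
qed simp

text \<open>If \<open>h x = h y\<close> with \<open>y\<close> in \<open>H\<close>, then
  \<open>x\<close> differs from \<open>y\<close> by a kernel element, which \<open>H\<close>
  absorbs. Properties of \<open>H\<close> expressed by membership thus survive in the image.\<close>

lemma (in ring_hom_ring) mem_image_ideal_iff:
  assumes "ideal H R" "a_kernel R S h \<subseteq> H" "x \<in> carrier R"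
  shows "h x \<in> h ` H \<longleftrightarrow> x \<in> H"
proof
  interpret H: ideal H R by fact
  assume "h x \<in> h ` H"
  then obtain y where y: "y \<in> H" "h x = h y" by (elim imageE)
  have carr: "x \<in> carrier R" "y \<in> carrier R" using assms(3) H.Icarr[OF y(1)] by simp_all
  have "h (x \<oplus> \<ominus> y) = \<zero>\<^bsub>S\<^esub>" using carr y(2) by (simp add: S.r_neg)
  then have "x \<oplus> \<ominus> y \<in> a_kernel R S h"
    unfolding a_kernel_def' using carr by (intro CollectI conjI) simp_all
  then have "x \<oplus> \<ominus> y \<in> H" by (rule subsetD[OF assms(2)])
  then have "(x \<oplus> \<ominus> y) \<oplus> y \<in> H" using y(1) by (rule H.a_closed)
  moreover have "(x \<oplus> \<ominus> y) \<oplus> y = x" using carr by (simp add: R.a_assoc R.l_neg)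
  ultimately show "x \<in> H" by simp
qed (rule imageI)

text \<open>Membership in the image reflects back to \<open>H\<close>, since \<open>H\<close>
  contains the kernel. Hence the image is proper, and a power of \<open>h x\<close> in the image
  gives the same power of \<open>x\<close> in \<open>H\<close>.\<close>

lemma (in ring_hom_ring) image_radical_ideal:
  assumes surj: "h ` carrier R = carrier S"
    and H: "radical_ideal H R" and ker: "a_kernel R S h \<subseteq> H"
  shows "radical_ideal (h ` H) S"
proof -
  have I: "ideal H R" and neq: "H \<noteq> carrier R" and rad: "ideal_radical R H = H"
    using H by (auto simp: radical_ideal_def)
  interpret H: ideal H R by fact
  note mem = mem_image_ideal_iff[OF I ker]
  have "h ` H \<noteq> carrier S"
  proof
    assume "h ` H = carrier S"
    then have "x \<in> H" if "x \<in> carrier R" for x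
      using mem[OF that] hom_closed[OF that] by simp
    with neq H.a_subset show False by (simp add: set_eq_subset subset_iff)
  qed
  moreover have "ideal_radical S (h ` H) = h ` H"
  proof
    show "ideal_radical S (h ` H) \<subseteq> h ` H"
    proof
      fix y assume "y \<in> ideal_radical S (h ` H)"
      then obtain n where "y \<in> carrier S" and n: "n > (0::nat)" "y [^]\<^bsub>S\<^esub> n \<in> h ` H"
        unfolding ideal_radical_def by (elim CollectE conjE exE)
      then obtain x where x: "x \<in> carrier R" "y = h x" unfolding surj[symmetric] by (elim imageE)
      have "x [^] n \<in> H" using n(2) x mem[of "x [^] n"] by (simp add: hom_nat_pow)
      with n(1) x(1) have "x \<in> ideal_radical R H" unfolding ideal_radical_def by blast
      with rad x(2) show "y \<in> h ` H" by blast
    qed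
    show "h ` H \<subseteq> ideal_radical S (h ` H)"
    proof
      fix y assume y: "y \<in> h ` H"
      then have "y \<in> carrier S" by auto
      \<comment> \<open>The exponent is 1 because \<open>ideal_radical\<close> admits only positive
        exponents.\<close>
      moreover from this y have "y [^]\<^bsub>S\<^esub> (1::nat) \<in> h ` H" by simp
      ultimately show "y \<in> ideal_radical S (h ` H)"
        unfolding ideal_radical_def by (intro CollectI conjI exI[of _ 1]) simp_all
    qed
  qed
  ultimately show ?thesis
    unfolding radical_ideal_def using image_ideal[OF surj I] by (intro conjI)
qed

section \<open>Invertible ideals under a surjective homomorphism\<close>

text \<open>This is the residual \<open>(R : J)\<close> in the total quotient ring, the largest
  candidate for an inverse of \<open>J\<close>.\<close>

definition fractional_inverse :: "('a, 'm) ring_scheme \<Rightarrow> 'a set \<Rightarrow> ('a \<times> 'a) set set" where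
  "fractional_inverse R J =
     {y \<in> carrier (total_quotient R). \<forall>j \<in> J. to_total_quotient R j \<otimes>\<^bsub>total_quotient R\<^esub> y \<in>
        to_total_quotient R ` carrier R}"

context cring
begin

lemma to_total_quotient_ring_hom: "ring_hom_ring R (total_quotient R) (to_total_quotient R)"
  using ring_axioms total_quotient_cring to_total_quotient_hom
  by (simp add: ring_hom_ringI2 cring.axioms(1))

lemma fractional_inverse_submodule:
  assumes "J \<subseteq> carrier R"
  shows "submodule (fractional_inverse R J) R (total_quotient R)"
proof -
  interpret T: cring "total_quotient R" by (rule total_quotient_cring)
  interpret alg: algebra R "total_quotient R" by (rule total_quotient_algebra)
  interpret \<iota>: ring_hom_ring R "total_quotient R" "to_total_quotient R"
    by (rule to_total_quotient_ring_hom)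
  let ?\<iota> = "to_total_quotient R"
  let ?T = "total_quotient R"
  show ?thesis
  proof (rule alg.submoduleI)
    show "fractional_inverse R J \<subseteq> carrier ?T"
      by (auto simp: fractional_inverse_def)
    show "\<zero>\<^bsub>?T\<^esub> \<in> fractional_inverse R J"
      using assms \<iota>.hom_zero by (auto simp: fractional_inverse_def subset_iff intro: rev_image_eqI)
  next
    fix y assume "y \<in> fractional_inverse R J"
    then have y: "y \<in> carrier ?T" "\<And>j. j \<in> J \<Longrightarrow> ?\<iota> j \<otimes>\<^bsub>?T\<^esub> y \<in> ?\<iota> ` carrier R"
      by (auto simp: fractional_inverse_def)
    have "?\<iota> j \<otimes>\<^bsub>?T\<^esub> (\<ominus>\<^bsub>?T\<^esub> y) \<in> ?\<iota> ` carrier R" if j: "j \<in> J" for j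
    proof -
      obtain a where "a \<in> carrier R" "?\<iota> j \<otimes>\<^bsub>?T\<^esub> y = ?\<iota> a" using y(2)[OF j] by blast
      moreover from this have "?\<iota> j \<otimes>\<^bsub>?T\<^esub> (\<ominus>\<^bsub>?T\<^esub> y) = ?\<iota> (\<ominus> a)"
        using j assms y(1) by (simp add: T.r_minus subset_iff)
      ultimately show ?thesis by blast
    qed
    then show "\<ominus>\<^bsub>?T\<^esub> y \<in> fractional_inverse R J"
      using y(1) by (simp add: fractional_inverse_def)
  next
    fix y z assume "y \<in> fractional_inverse R J" "z \<in> fractional_inverse R J"
    then have y: "y \<in> carrier ?T" "\<And>j. j \<in> J \<Longrightarrow> ?\<iota> j \<otimes>\<^bsub>?T\<^esub> y \<in> ?\<iota> ` carrier R"
      and z: "z \<in> carrier ?T" "\<And>j. j \<in> J \<Longrightarrow> ?\<iota> j \<otimes>\<^bsub>?T\<^esub> z \<in> ?\<iota> ` carrier R"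
      by (auto simp: fractional_inverse_def)
    have "?\<iota> j \<otimes>\<^bsub>?T\<^esub> (y \<oplus>\<^bsub>?T\<^esub> z) \<in> ?\<iota> ` carrier R" if j: "j \<in> J" for j
    proof -
      obtain a b where "a \<in> carrier R" "?\<iota> j \<otimes>\<^bsub>?T\<^esub> y = ?\<iota> a" "b \<in> carrier R" "?\<iota> j \<otimes>\<^bsub>?T\<^esub> z = ?\<iota> b"
        using y(2)[OF j] z(2)[OF j] by blast
      moreover from this have "?\<iota> j \<otimes>\<^bsub>?T\<^esub> (y \<oplus>\<^bsub>?T\<^esub> z) = ?\<iota> (a \<oplus> b)"
        using j assms y(1) z(1) by (simp add: T.r_distr subset_iff)
      ultimately show ?thesis by blast
    qed
    then show "y \<oplus>\<^bsub>?T\<^esub> z \<in> fractional_inverse R J"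
      using y(1) z(1) by (simp add: fractional_inverse_def)
  next
    fix c y assume c: "c \<in> carrier R" and "y \<in> fractional_inverse R J"
    then have y: "y \<in> carrier ?T" "\<And>j. j \<in> J \<Longrightarrow> ?\<iota> j \<otimes>\<^bsub>?T\<^esub> y \<in> ?\<iota> ` carrier R"
      by (auto simp: fractional_inverse_def)
    \<comment> \<open>The scalar action is multiplication by the image of \<open>c\<close>, so
      commutativity can move \<open>c\<close> in front of \<open>j\<close>.\<close>
    have smult: "c \<odot>\<^bsub>?T\<^esub> y = ?\<iota> c \<otimes>\<^bsub>?T\<^esub> y"
      using y(1) c by (elim total_quotient_cases)
        (simp add: to_total_quotient_def total_quotient_smult total_quotient_mult)
    have "?\<iota> j \<otimes>\<^bsub>?T\<^esub> (c \<odot>\<^bsub>?T\<^esub> y) \<in> ?\<iota> ` carrier R" if j: "j \<in> J" for j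
    proof -
      obtain a where a: "a \<in> carrier R" "?\<iota> j \<otimes>\<^bsub>?T\<^esub> y = ?\<iota> a" using y(2)[OF j] by blast
      have "?\<iota> j \<otimes>\<^bsub>?T\<^esub> (c \<odot>\<^bsub>?T\<^esub> y) = ?\<iota> c \<otimes>\<^bsub>?T\<^esub> (?\<iota> j \<otimes>\<^bsub>?T\<^esub> y)"
        unfolding smult using j assms y(1) c by (intro T.m_lcomm) auto
      also have "\<dots> = ?\<iota> (c \<otimes> a)" using a c by simp
      finally show ?thesis using a(1) c by blast
    qed
    then show "c \<odot>\<^bsub>?T\<^esub> y \<in> fractional_inverse R J"
      using y(1) c by (simp add: fractional_inverse_def)
  qed
qed

text \<open>The product of \<open>J\<close> with its residual always lies in \<open>R\<close> and is
  closed under multiplication by \<open>R\<close>. Once it contains 1, it is all of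
  \<open>R\<close>.\<close>

lemma invertible_idealI:
  assumes "ideal J R"
    and one: "\<one>\<^bsub>total_quotient R\<^esub> \<in>
      (to_total_quotient R ` J) \<cdot>\<^bsub>total_quotient R\<^esub> fractional_inverse R J"
  shows "invertible_ideal J R"
proof -
  interpret T: cring "total_quotient R" by (rule total_quotient_cring)
  interpret \<iota>: ring_hom_ring R "total_quotient R" "to_total_quotient R"
    by (rule to_total_quotient_ring_hom)
  interpret J: ideal J R by fact
  let ?\<iota> = "to_total_quotient R"
  let ?T = "total_quotient R"
  let ?P = "(?\<iota> ` J) \<cdot>\<^bsub>?T\<^esub> fractional_inverse R J"
  have sub: "z \<in> ?\<iota> ` carrier R" if "z \<in> ?P" for z
    using that
  proof induction
    case (prod i j)
    then show ?case by (auto simp: fractional_inverse_def)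
  next
    case (sum s t)
    then obtain a b where "a \<in> carrier R" "s = ?\<iota> a" "b \<in> carrier R" "t = ?\<iota> b" by blast
    moreover from this have "s \<oplus>\<^bsub>?T\<^esub> t = ?\<iota> (a \<oplus> b)" by simp
    ultimately show ?case by blast
  qed
  \<comment> \<open>In a product, the factor \<open>c\<close> is absorbed into the element of
    \<open>J\<close>.\<close>
  have closed: "?\<iota> c \<otimes>\<^bsub>?T\<^esub> z \<in> ?P" if "z \<in> ?P" "c \<in> carrier R" for z c
    using that(1)
  proof induction
    case (prod i y)
    then obtain j where j: "j \<in> J" "i = ?\<iota> j" by blast
    have "y \<in> carrier ?T" using prod by (simp add: fractional_inverse_def)
    then have "?\<iota> c \<otimes>\<^bsub>?T\<^esub> (i \<otimes>\<^bsub>?T\<^esub> y) = ?\<iota> (c \<otimes> j) \<otimes>\<^bsub>?T\<^esub> y"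
      using j that(2) by (simp add: T.m_assoc)
    moreover have "c \<otimes> j \<in> J" using j that(2) by (simp add: J.I_l_closed)
    ultimately show ?case using prod(2) by (metis (no_types, lifting) ideal_prod.prod image_eqI)
  next
    case (sum s t)
    have "s \<in> carrier ?T" "t \<in> carrier ?T" using sub[OF sum.hyps(1)] sub[OF sum.hyps(2)] by auto
    with sum that(2) show ?case by (simp add: T.r_distr ideal_prod.sum)
  qed
  have "?P = ?\<iota> ` carrier R"
  proof (intro equalityI subsetI)
    fix z assume "z \<in> ?\<iota> ` carrier R"
    then obtain c where "c \<in> carrier R" "z = ?\<iota> c" by blast
    with closed[OF one] show "z \<in> ?P" by simp
  qed (rule sub)
  with assms(1) fractional_inverse_submodule[OF J.a_subset] show ?thesis
    unfolding invertible_ideal_def by blast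
qed

end

text \<open>In general \<open>h\<close> does not extend to the total quotient rings, since it may
  send regular elements to zero-divisors. Only products \<open>j x\<close> lying in \<open>R\<close>
  can be transported; \<open>h r\<close> serves as a common denominator for them.\<close>

lemma (in ring_hom_cring) image_invertible_ideal:
  assumes surj: "h ` carrier R = carrier S"
    and J: "invertible_ideal J R"
    and r: "r \<in> J" "h r \<in> regular_elements S"
  shows "invertible_ideal (h ` J) S"
proof -
  obtain J' where ideal: "ideal J R" and sub: "submodule J' R (total_quotient R)"
    and eq: "(to_total_quotient R ` J) \<cdot>\<^bsub>total_quotient R\<^esub> J' = to_total_quotient R ` carrier R"
    using J unfolding invertible_ideal_def by blast
  interpret J: ideal J R by fact
  interpret T: cring "total_quotient R" by (rule R.total_quotient_cring)
  interpret \<iota>: ring_hom_ring R "total_quotient R" "to_total_quotient R"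
    by (rule R.to_total_quotient_ring_hom)
  interpret \<kappa>: ring_hom_ring S "total_quotient S" "to_total_quotient S"
    by (rule S.to_total_quotient_ring_hom)
  interpret algebra R "total_quotient R" by (rule R.total_quotient_algebra)
  let ?\<iota> = "to_total_quotient R" and ?T = "total_quotient R"
  let ?\<kappa> = "to_total_quotient S" and ?U = "total_quotient S"
  have inj: "a = b" if "?\<iota> a = ?\<iota> b" "a \<in> carrier R" "b \<in> carrier R" for a b
    using that R.to_total_quotient_inj by (auto dest: inj_onD)
  have J'_carr: "J' \<subseteq> carrier ?T" using submoduleE(1)[OF sub] .
  \<comment> \<open>Here \<open>y\<close> stands in for the missing image of \<open>x\<close>: it is
    characterized by its products with the elements \<open>h j\<close>.\<close>
  have transfer: "\<exists>y \<in> fractional_inverse S (h ` J). \<forall>j \<in> J. \<forall>a \<in> carrier R.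
      ?\<iota> j \<otimes>\<^bsub>?T\<^esub> x = ?\<iota> a \<longrightarrow> ?\<kappa> (h j) \<otimes>\<^bsub>?U\<^esub> y = ?\<kappa> (h a)" if x: "x \<in> J'" for x
  proof -
    have xT: "x \<in> carrier ?T" using x J'_carr by blast
    have ex: "\<exists>a \<in> carrier R. ?\<iota> j \<otimes>\<^bsub>?T\<^esub> x = ?\<iota> a" if "j \<in> J" for j
    proof -
      have "?\<iota> j \<otimes>\<^bsub>?T\<^esub> x \<in> (?\<iota> ` J) \<cdot>\<^bsub>?T\<^esub> J'" using x that by (simp add: ideal_prod.prod)
      then show ?thesis unfolding eq by blast
    qed
    obtain c where c: "c \<in> carrier R" "?\<iota> r \<otimes>\<^bsub>?T\<^esub> x = ?\<iota> c" using ex[OF r(1)] by blast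
    define y where "y = quot_frac S (h c) (h r)"
    have main: "?\<kappa> (h j) \<otimes>\<^bsub>?U\<^esub> y = ?\<kappa> (h a)"
      if j: "j \<in> J" "a \<in> carrier R" "?\<iota> j \<otimes>\<^bsub>?T\<^esub> x = ?\<iota> a" for j a
    proof -
      \<comment> \<open>The two ways of bracketing \<open>j r x\<close> give an equation in
        \<open>T(R)\<close>. Injectivity of \<open>\<iota>\<close> brings it down to
        \<open>R\<close>, where \<open>h\<close> applies and yields the cross-multiplied form of the
        claim.\<close>
      have "?\<iota> (j \<otimes> c) = ?\<iota> j \<otimes>\<^bsub>?T\<^esub> (?\<iota> r \<otimes>\<^bsub>?T\<^esub> x)" using j c by simp
      also have "\<dots> = ?\<iota> r \<otimes>\<^bsub>?T\<^esub> (?\<iota> j \<otimes>\<^bsub>?T\<^esub> x)" using j(1) r(1) xT by (intro T.m_lcomm) auto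
      also have "\<dots> = ?\<iota> (r \<otimes> a)" using j r(1) by simp
      finally have "j \<otimes> c = r \<otimes> a" by (rule inj) (use j r(1) c in auto)
      then have "h j \<otimes>\<^bsub>S\<^esub> h c = h r \<otimes>\<^bsub>S\<^esub> h a"
        using j r(1) c by (metis J.Icarr hom_mult)
      then show ?thesis
        using j r c unfolding y_def to_total_quotient_def
        by (simp add: S.total_quotient_mult S.frac_eq_iff S.m_comm)
    qed
    have "y \<in> carrier ?U" using c(1) r(2) by (simp add: y_def)
    moreover have "?\<kappa> (h j) \<otimes>\<^bsub>?U\<^esub> y \<in> ?\<kappa> ` carrier S" if "j \<in> J" for j
      using ex[OF that] main[OF that] by auto
    ultimately have "y \<in> fractional_inverse S (h ` J)"
      by (simp add: fractional_inverse_def)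
    with main show ?thesis by blast
  qed
  let ?P = "(?\<kappa> ` h ` J) \<cdot>\<^bsub>?U\<^esub> fractional_inverse S (h ` J)"
  \<comment> \<open>Only the element 1 is wanted in the end, but the induction has to follow every
    partial sum. Since \<open>h\<close> cannot act on \<open>z\<close>, the claim speaks of its
    preimages \<open>a\<close> in \<open>R\<close>.\<close>
  have lift: "\<forall>a \<in> carrier R. z = ?\<iota> a \<longrightarrow> ?\<kappa> (h a) \<in> ?P" if "z \<in> (?\<iota> ` J) \<cdot>\<^bsub>?T\<^esub> J'" for z
    using that
  proof induction
    case (prod i x)
    then obtain j where j: "j \<in> J" "i = ?\<iota> j" by blast
    obtain y where y: "y \<in> fractional_inverse S (h ` J)"
      "\<forall>a \<in> carrier R. ?\<iota> j \<otimes>\<^bsub>?T\<^esub> x = ?\<iota> a \<longrightarrow> ?\<kappa> (h j) \<otimes>\<^bsub>?U\<^esub> y = ?\<kappa> (h a)"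
      using transfer[OF prod(2)] j(1) by blast
    have "?\<kappa> (h j) \<otimes>\<^bsub>?U\<^esub> y \<in> ?P" using y(1) j(1) by (simp add: ideal_prod.prod)
    then show ?case using y(2) j(2) by metis
  next
    case (sum s t)
    \<comment> \<open>Both summands lie in \<open>J J' = R\<close>, so each has a preimage to which
      the induction hypothesis applies.\<close>
    obtain b c where bc: "b \<in> carrier R" "s = ?\<iota> b" "c \<in> carrier R" "t = ?\<iota> c"
      using sum.hyps unfolding eq by blast
    show ?case
    proof (intro ballI impI)
      fix a assume "a \<in> carrier R" "s \<oplus>\<^bsub>?T\<^esub> t = ?\<iota> a"
      then have "a = b \<oplus> c" using bc by (intro inj) simp_all
      then have "?\<kappa> (h a) = ?\<kappa> (h b) \<oplus>\<^bsub>?U\<^esub> ?\<kappa> (h c)" using bc by simp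
      then show "?\<kappa> (h a) \<in> ?P" using sum.IH bc by (simp add: ideal_prod.sum)
    qed
  qed
  have "?\<iota> \<one> \<in> (?\<iota> ` J) \<cdot>\<^bsub>?T\<^esub> J'" unfolding eq by blast
  from lift[OF this] have "?\<kappa> (h \<one>) \<in> ?P" by blast
  then have "\<one>\<^bsub>?U\<^esub> \<in> ?P" by simp
  with ring.image_ideal[OF surj ideal] show ?thesis
    by (rule S.invertible_idealI)
qed

section \<open>Passage of the ISP factorization from \<open>A\<close> to \<open>B\<close>\<close>

theorem proposition2p3:
  fixes A :: "('a, 'm) ring_scheme" and B :: "('b, 'n) ring_scheme" and f :: "'a \<Rightarrow> 'b"
  assumes "cring A" and "\<one>\<^bsub>A\<^esub> \<noteq> \<zero>\<^bsub>A\<^esub>"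
    and "cring B" and "\<one>\<^bsub>B\<^esub> \<noteq> \<zero>\<^bsub>B\<^esub>"
    and "f \<in> ring_hom A B" and "f ` carrier A = carrier B"
    and "primeideal (a_kernel A B f) A"
    and "\<And>I. regular_ideal I B \<Longrightarrow> regular_ideal {a \<in> carrier A. f a \<in> I} A"
    and "ISP_ring A"
  shows "ISP_ring B"
proof -
  interpret A: ISP_ring A by fact
  interpret B: cring B by fact
  interpret f: ring_hom_cring A B f
    by (intro ring_hom_cring.intro ring_hom_cring_axioms.intro assms)
  note surj = assms(6)
  show ?thesis
  proof (intro ISP_ring.intro ISP_ring_axioms.intro assms(3,4))
    fix I assume I: "regular_ideal I B" and proper: "I \<noteq> carrier B"
    interpret I: ideal I B using I by (simp add: regular_ideal_def)
    define K where "K = {a \<in> carrier A. f a \<in> I}"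
    have K_regular: "regular_ideal K A" unfolding K_def by (rule assms(8)[OF I])
    have image_K: "f ` K = I" unfolding K_def using surj I.a_subset by (auto simp: image_iff)
    \<comment> \<open>Otherwise surjectivity would make \<open>I = f K\<close> all of
      \<open>B\<close>.\<close>
    have "K \<noteq> carrier A" using image_K surj proper by metis
    from A.ISP[OF K_regular this] obtain J Hs where J: "invertible_ideal J A" and "Hs \<noteq> []"
      and Hs: "\<forall>H \<in> set Hs. radical_ideal H A" and K: "K = foldl (ideal_prod A) J Hs"
      by blast
    have ideals: "ideal J A" "\<forall>H \<in> set Hs. ideal H A"
      using J Hs by (auto simp: invertible_ideal_def radical_ideal_def)
    have K_sub: "K \<subseteq> J" "\<And>H. H \<in> set Hs \<Longrightarrow> K \<subseteq> H"
      using A.foldl_ideal_prod_subset[OF ideals] K by simp_all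
    \<comment> \<open>As the preimage of an ideal, \<open>K\<close> contains the kernel; by
      \<open>K_sub\<close> so does every \<open>H\<close>, as required for its image to be
      radical.\<close>
    have ker: "a_kernel A B f \<subseteq> K"
    proof
      fix x assume "x \<in> a_kernel A B f"
      then have "x \<in> carrier A" "f x = \<zero>\<^bsub>B\<^esub>" unfolding a_kernel_def' by blast+
      then show "x \<in> K" unfolding K_def using I.zero_closed by simp
    qed
    \<comment> \<open>A regular element of \<open>I\<close> lifts to \<open>K\<close>, hence to
      \<open>J\<close>. Its lift \<open>r\<close> need not be regular in \<open>A\<close>; what
      matters is that \<open>f r\<close> can be a denominator.\<close>
    obtain s where s: "s \<in> I" "s \<in> regular_elements B" using I by (auto simp: regular_ideal_def)
    then obtain r where r: "r \<in> J" "f r \<in> regular_elements B"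
      using image_K K_sub(1) by (metis imageE subsetD)
    have "invertible_ideal (f ` J) B" by (rule f.image_invertible_ideal[OF surj J r])
    moreover have "\<forall>H \<in> set (map ((`) f) Hs). radical_ideal H B"
      using Hs f.ring.image_radical_ideal[OF surj] subset_trans[OF ker K_sub(2)] by simp
    moreover have "I = foldl (ideal_prod B) (f ` J) (map ((`) f) Hs)"
      using f.ring.image_foldl_ideal_prod[OF ideals] image_K K by simp
    moreover have "map ((`) f) Hs \<noteq> []" using \<open>Hs \<noteq> []\<close> by simp
    ultimately show "\<exists>J Hs. invertible_ideal J B \<and> Hs \<noteq> [] \<and> (\<forall>H \<in> set Hs. radical_ideal H B) \<and>
        I = foldl (ideal_prod B) J Hs" by blast
  qed
qed

end
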